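(* Let $\mathcal{G}$ be an undirected, connected graph of order $n$. Let $S_2=\{s_1,s_2\}$ be a set of two noise-corrupted leaders ($0<k<\infty$). Define the $k$-dependent joint centrality of $S_2$ as $$\rho_{kS_2}=n\Big(\frac{K_f}{n}+\frac{n\,[1+k(L^+_{s_1,s_1}+L^+_{s_2,s_2})]}{k(2+k\,r_{s_1,s_2})}+\frac{nk^2\big(L^+_{s_1,s_1}L^+_{s_2,s_2}-(L^+_{s_1,s_2})^2\big)-k^2\gamma_{s_1,s_2}}{k(2+k\,r_{s_1,s_2})}\Big)^{-1}.$$ Then the total system error of the leader-follower dynamics $d\mathbf{x}=-M\mathbf{x}\,dt+\sigma\,d\mathbf{W}$ is $$\sum_{i=1}^n\Sigma_{i,i}=\frac{\sigma^2}{2}\left(\frac{n}{\rho_{kS_2}}\right).$$ The optimal leader set (among sets of two noise-corrupted leaders, for the given $k$) is $S_2^*=\{s_1^*,s_2^*\}=\arg\max_{s_1,s_2}\rho_{kS_2}$, the two nodes with maximal $k$-dependent joint centrality.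
   Context: Setting. $\mathcal{G}$ is an undirected connected graph on nodes $\{1,\dots,n\}$ with symmetric adjacency matrix $A$ ($a_{i,j}=a_{j,i}>0$ if $(i,j)$ is an edge, $a_{i,j}=0$ otherwise), $D$ is the diagonal matrix with $d_{i,i}=\sum_j a_{i,j}$, and $L=D-A$ is the Laplacian. $B^+$ denotes the Moore-Penrose pseudoinverse of $B$. Dynamics and error. Let $S$ be a nonempty set of nodes (leaders; here $S=S_2$ with $s_1\neq s_2$), $k>0$, and $K$ the diagonal matrix with $K_{i,i}=k$ for $i\in S$ and $K_{i,i}=0$ otherwise; $M=L+K$. For $\sigma>0$ the dynamics are $d\mathbf{x}=-M\mathbf{x}\,dt+\sigma\,d\mathbf{W}$, with $\mathbf{W}$ a vector of $n$ independent standard Wiener processes. $\Sigma$ is the steady-state covariance matrix of $\mathbf{x}$, i.e. the solution of $M\Sigma+\Sigma M^T=\sigma^2 I$. The total system error is $\mathrm{tr}(\Sigma)=\sum_{i=1}^n\Sigma_{i,i}=\frac{\sigma^2}{2}\sum_{i=1}^n (M^{-1})_{i,i}$. The leaders are called noise-corrupted if $0<k<\infty$. For given $m$ (here $m=2$), an optimal leader set is a set of $m$ nodes minimizing the total system error over all sets of $m$ nodes. Graph quantities. $K_f=n\,\mathrm{Tr}(L^+)$ is the Kirchhoff index; $r_{i,j}=L^+_{i,i}+L^+_{j,j}-2L^+_{i,j}$ is the resistance distance; $\gamma_{i,j}=(L^2)^+_{i,i}+(L^2)^+_{j,j}-2(L^2)^+_{i,j}=\sum_{l=1}^n(L^+_{l,i}-L^+_{l,j})^2$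 is the biharmonic distance. *)

theory Defs
  imports "HOL-Analysis.Analysis"
begin

section \<open>Weighted undirected graphs and their Laplacians\<close>

text \<open>
  The nodes are the elements of the finite index type, so the order of the graph is
  \<open>CARD('n)\<close>. Self-loops are allowed; they cancel in the Laplacian.
\<close>

definition undirected_graph :: "('n \<times> 'n) set \<Rightarrow> real^'n^'n \<Rightarrow> bool" where
  "undirected_graph E A \<longleftrightarrow>
     sym E \<and> transpose A = A \<and>
     (\<forall>i j. if (i, j) \<in> E then A $ i $ j > 0 else A $ i $ j = 0)"

definition connected_graph :: "('n \<times> 'n) set \<Rightarrow> bool" where
  "connected_graph E \<longleftrightarrow> (\<forall>i j. (i, j) \<in> E\<^sup>*)"

definition degree_matrix :: "real^'n^'n \<Rightarrow> real^'n^'n" where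
  "degree_matrix A = (\<chi> i j. if i = j then (\<Sum>l\<in>UNIV. A $ i $ l) else 0)"

definition laplacian :: "real^'n^'n \<Rightarrow> real^'n^'n" where
  "laplacian A = degree_matrix A - A"


section \<open>Moore-Penrose pseudoinverse\<close>

text \<open>
  The four Penrose conditions determine the pseudoinverse of a real matrix uniquely. Note that
  \<^const>\<open>matrix_inv\<close> is unspecified on singular matrices.
\<close>

definition is_pseudoinverse :: "real^'n^'m \<Rightarrow> real^'m^'n \<Rightarrow> bool" where
  "is_pseudoinverse B X \<longleftrightarrow>
     B ** X ** B = B \<and> X ** B ** X = X \<and>
     transpose (B ** X) = B ** X \<and> transpose (X ** B) = X ** B"

definition pseudoinverse :: "real^'n^'m \<Rightarrow> real^'m^'n" where
  "pseudoinverse B = (THE X. is_pseudoinverse B X)"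


section \<open>Graph quantities\<close>

definition kirchhoff_index :: "real^'n^'n \<Rightarrow> real" where
  "kirchhoff_index A = real CARD('n) * trace (pseudoinverse (laplacian A))"

definition resistance_distance :: "real^'n^'n \<Rightarrow> 'n \<Rightarrow> 'n \<Rightarrow> real" where
  "resistance_distance A i j =
     (let P = pseudoinverse (laplacian A) in P $ i $ i + P $ j $ j - 2 * P $ i $ j)"

definition biharmonic_distance :: "real^'n^'n \<Rightarrow> 'n \<Rightarrow> 'n \<Rightarrow> real" where
  "biharmonic_distance A i j =
     (let Q = pseudoinverse (laplacian A ** laplacian A)
      in Q $ i $ i + Q $ j $ j - 2 * Q $ i $ j)"

definition joint_centrality :: "real^'n^'n \<Rightarrow> real \<Rightarrow> 'n \<Rightarrow> 'n \<Rightarrow> real" where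
  "joint_centrality A k s1 s2 =
     (let n = real CARD('n);
          P = pseudoinverse (laplacian A);
          r = resistance_distance A s1 s2;
          \<gamma> = biharmonic_distance A s1 s2
      in n * inverse
          (kirchhoff_index A / n
           + n * (1 + k * (P $ s1 $ s1 + P $ s2 $ s2)) / (k * (2 + k * r))
           + (n * k\<^sup>2 * (P $ s1 $ s1 * P $ s2 $ s2 - (P $ s1 $ s2)\<^sup>2) - k\<^sup>2 * \<gamma>)
             / (k * (2 + k * r))))"


section \<open>Leader-follower dynamics\<close>

definition leader_gain_matrix :: "real \<Rightarrow> 'n set \<Rightarrow> real^'n^'n" where
  "leader_gain_matrix k S = (\<chi> i j. if i = j \<and> i \<in> S then k else 0)"

definition dynamics_matrix :: "real^'n^'n \<Rightarrow> real \<Rightarrow> 'n set \<Rightarrow> real^'n^'n" where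
  "dynamics_matrix A k S = laplacian A + leader_gain_matrix k S"

text \<open>
  The steady-state covariance of \<open>dx = - M x dt + \<sigma> dW\<close>, where \<open>W\<close> is a vector of independent
  standard Wiener processes, is the solution of the Lyapunov equation. It is unique when
  \<open>M\<close> is positive definite, as it is for a connected graph with a nonempty leader set and
  \<open>k > 0\<close>. The matrix \<open>mat c\<close> is \<open>c\<close> times the identity.
\<close>

definition is_steady_state_covariance :: "real^'n^'n \<Rightarrow> real \<Rightarrow> real^'n^'n \<Rightarrow> bool" where
  "is_steady_state_covariance M \<sigma> \<Sigma> \<longleftrightarrow> M ** \<Sigma> + \<Sigma> ** transpose M = mat (\<sigma>\<^sup>2)"

definition steady_state_covariance :: "real^'n^'n \<Rightarrow> real \<Rightarrow> real^'n^'n" where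
  "steady_state_covariance M \<sigma> = (THE \<Sigma>. is_steady_state_covariance M \<sigma> \<Sigma>)"

definition total_system_error :: "real^'n^'n \<Rightarrow> real \<Rightarrow> real \<Rightarrow> 'n set \<Rightarrow> real" where
  "total_system_error A k \<sigma> S = trace (steady_state_covariance (dynamics_matrix A k S) \<sigma>)"

definition optimal_leader_set :: "real^'n^'n \<Rightarrow> real \<Rightarrow> real \<Rightarrow> nat \<Rightarrow> 'n set \<Rightarrow> bool" where
  "optimal_leader_set A k \<sigma> m S \<longleftrightarrow>
     is_arg_min (total_system_error A k \<sigma>) (\<lambda>T. card T = m) S"

end

theory Submission
  imports Defs
begin

text \<open>
  Write \<open>L\<close> for the Laplacian, \<open>P\<close> for its pseudoinverse, \<open>J\<close> for the orthogonal projection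
  onto the constant vectors, and \<open>M = L + K\<close> for the matrix of the dynamics. Connectedness makes
  the constants the whole kernel of \<open>L\<close>, so a nonempty leader set makes \<open>M\<close> positive definite.
  The Lyapunov equation then has exactly one solution, \<open>\<sigma>\<^sup>2 / 2\<close> times the inverse of \<open>M\<close>
  (\<open>steady_state_covariance_eq\<close>), and the total system error is \<open>\<sigma>\<^sup>2 / 2\<close> times the trace of
  that inverse.

  Everything is thus reduced to computing this trace for two leaders. Read \<open>M x = b\<close> as an
  electrical network whose two leaders are grounded through conductances \<open>k\<close>: the network part
  \<open>L x = b - K x\<close> determines \<open>x\<close> up to an additive constant by \<open>P\<close>, so the only unknowns are the
  two leader potentials and that constant, a three-by-three linear problem. Solving it gives an
  explicit inverse of \<open>M\<close>: the matrix \<open>P\<close>, minus a rank-one matrix built from the column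
  difference \<open>p = P (e\<^sub>1 - e\<^sub>2)\<close>, plus terms that are constant along rows or along columns
  (\<open>dynamics_matrix_inverse_two_leaders\<close>). In the trace, the rank-one part contributes the
  squared norm of \<open>p\<close>, which is the biharmonic distance because the pseudoinverse of \<open>L\<^sup>2\<close> is
  \<open>P\<^sup>2\<close>; the row and column terms cancel because columns of \<open>P\<close> sum to zero, except for
  one global constant. The result is the expression whose inverse defines the joint centrality.

  Since that expression is the trace of the inverse of a positive definite matrix, it is positive.
  The error is therefore a strictly decreasing function of the joint centrality, and minimizing the
  one over pairs of nodes is maximizing the other.
\<close>

section \<open>Matrix algebra\<close>

lemma matrix_diff_ldistrib: "A ** (B - C) = A ** B - A ** C"
  for A :: "'a::ring_1^'n^'m"
  by (vector matrix_matrix_mult_def sum_subtractf right_diff_distrib)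

lemma matrix_diff_rdistrib: "(B - C) ** A = B ** A - C ** A"
  for A :: "'a::ring_1^'n^'m"
  by (vector matrix_matrix_mult_def sum_subtractf left_diff_distrib)

lemma matrix_add_rdistrib: "(B + C) ** A = B ** A + C ** A"
  for A :: "'a::semiring_1^'n^'m"
  by (vector matrix_matrix_mult_def sum.distrib distrib_right)

lemma transpose_diff: "transpose (A - B) = transpose A - transpose B"
  for A :: "'a::ring_1^'n^'m"
  by (vector transpose_def)

lemma matrix_matrix_mult_component: "(A ** B) $ i $ j = (\<Sum>l\<in>UNIV. A $ i $ l * B $ l $ j)"
  by (simp add: matrix_matrix_mult_def)

lemma symmetric_matrix_component:
  assumes "transpose M = M"
  shows "M $ i $ j = M $ j $ i"
  using assms by (metis transpose_def vec_lambda_beta)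

definition positive_definite :: "real^'n^'n \<Rightarrow> bool" where
  "positive_definite M \<longleftrightarrow> (\<forall>x. x \<noteq> 0 \<longrightarrow> x \<bullet> (M *v x) > 0)"

lemma positive_definite_right_inverse:
  fixes M :: "real^'n^'n"
  assumes "positive_definite M"
  obtains N where "M ** N = mat 1"
proof -
  have "inj ((*v) M)"
  proof (rule injI)
    fix x y :: "real^'n" assume "M *v x = M *v y"
    hence "(x - y) \<bullet> (M *v (x - y)) = 0" by (simp add: matrix_vector_mult_diff_distrib)
    thus "x = y" using assms unfolding positive_definite_def by (metis less_irrefl right_minus_eq)
  qed
  thus ?thesis using that by (metis matrix_left_invertible_injective matrix_left_right_inverse)
qed

text \<open>
  If \<open>y\<close> is the \<open>i\<close>-th column of the inverse \<open>N\<close>, then \<open>M y\<close> is the \<open>i\<close>-th unit vector, so the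
  quadratic form of \<open>M\<close> at \<open>y\<close> is the diagonal entry \<open>N\<^sub>i\<^sub>i\<close>.
\<close>
lemma trace_inverse_positive:
  fixes M N :: "real^'n^'n"
  assumes pd: "positive_definite M" and MN: "M ** N = mat 1"
  shows "trace N > 0"
proof -
  have "N $ i $ i > 0" for i
  proof -
    have col: "M *v column i N = axis i 1"
    proof -
      have "M *v column i N = column i (M ** N)"
        by (vector column_def matrix_vector_mult_def matrix_matrix_mult_def)
      also have "\<dots> = axis i 1"
        unfolding MN by (vector column_def mat_def axis_def)
      finally show ?thesis .
    qed
    hence "column i N \<noteq> 0"
      by (metis axis_eq_0_iff matrix_vector_mult_0_right zero_neq_one)
    hence "column i N \<bullet> (M *v column i N) > 0"
      using pd unfolding positive_definite_def by blast
    thus ?thesis unfolding col by (simp add: inner_axis column_def)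
  qed
  thus ?thesis unfolding trace_def by (intro sum_pos) auto
qed


section \<open>The Lyapunov equation\<close>

text \<open>
  The trace below is the sum of the quadratic form of \<open>M\<close> over the columns of \<open>X\<close>. It serves as a
  norm that detects \<open>X = 0\<close> when \<open>M\<close> is positive definite.
\<close>
lemma trace_congruence:
  fixes M :: "real^'n^'n" and X :: "real^'m^'n"
  shows "trace (transpose X ** (M ** X)) = (\<Sum>j\<in>UNIV. column j X \<bullet> (M *v column j X))"
  by (simp add: trace_def matrix_matrix_mult_def transpose_def inner_vec_def column_def
      matrix_vector_mult_def)

lemma trace_congruence_nonneg:
  assumes "positive_definite M"
  shows "trace (transpose X ** (M ** X)) \<ge> 0"
  unfolding trace_congruence
proof (intro sum_nonneg)
  fix j show "column j X \<bullet> (M *v column j X) \<ge> 0"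
    using assms unfolding positive_definite_def
    by (cases "column j X = 0") (auto simp: less_imp_le)
qed

lemma trace_congruence_eq_0:
  assumes pd: "positive_definite M" and "trace (transpose X ** (M ** X)) = 0"
  shows "X = 0"
proof -
  have nn: "column j X \<bullet> (M *v column j X) \<ge> 0" for j
    using pd unfolding positive_definite_def
    by (cases "column j X = 0") (auto simp: less_imp_le)
  have "column j X \<bullet> (M *v column j X) = 0" for j
    using assms(2) unfolding trace_congruence by (subst (asm) sum_nonneg_eq_0_iff) (auto simp: nn)
  hence "column j X = 0" for j
    using pd unfolding positive_definite_def by (metis less_irrefl)
  thus ?thesis by (simp add: vec_eq_iff column_def)
qed

text \<open>
  Pair the equation with \<open>X\<close> in the trace inner product. The two resulting terms are the traces
  of the congruences of \<open>M\<close> by \<open>X\<close> and by its transpose; both are nonnegative and their sum is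
  zero, so both vanish.
\<close>
lemma lyapunov_kernel_trivial:
  fixes M X :: "real^'n^'n"
  assumes pd: "positive_definite M" and eq: "M ** X + X ** M = 0"
  shows "X = 0"
proof -
  have "trace (transpose X ** (M ** X)) + trace (transpose X ** (X ** M)) = 0"
    using arg_cong[OF eq, of "\<lambda>Y. trace (transpose X ** Y)"]
    by (simp add: matrix_add_ldistrib trace_add trace_0[unfolded mat_0])
  moreover have "trace (transpose X ** (X ** M))
      = trace (transpose (transpose X) ** (M ** transpose X))"
    by (subst trace_mul_sym) (simp add: matrix_mul_assoc)
  ultimately have "trace (transpose X ** (M ** X)) = 0"
    using trace_congruence_nonneg[OF pd, of X] trace_congruence_nonneg[OF pd, of "transpose X"]
    by linarith
  thus ?thesis by (rule trace_congruence_eq_0[OF pd])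
qed

lemma steady_state_covariance_eq:
  fixes M N :: "real^'n^'n"
  assumes pd: "positive_definite M" and sym: "transpose M = M" and MN: "M ** N = mat 1"
  shows "steady_state_covariance M \<sigma> = (\<sigma>\<^sup>2 / 2) *\<^sub>R N"
  unfolding steady_state_covariance_def
proof (rule the_equality)
  have NM: "N ** M = mat 1" using MN by (simp add: matrix_left_right_inverse)
  show sol: "is_steady_state_covariance M \<sigma> ((\<sigma>\<^sup>2 / 2) *\<^sub>R N)"
    unfolding is_steady_state_covariance_def sym
    by (simp add: scalar_matrix_assoc[symmetric] matrix_scalar_ac MN NM)
       (simp add: vec_eq_iff mat_def)
  fix Y assume "is_steady_state_covariance M \<sigma> Y"
  with sol have "M ** (Y - (\<sigma>\<^sup>2 / 2) *\<^sub>R N) + (Y - (\<sigma>\<^sup>2 / 2) *\<^sub>R N) ** M = 0"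
    unfolding is_steady_state_covariance_def sym matrix_diff_ldistrib matrix_diff_rdistrib
    by (simp add: algebra_simps)
  from lyapunov_kernel_trivial[OF pd this] show "Y = (\<sigma>\<^sup>2 / 2) *\<^sub>R N" by simp
qed


section \<open>Pseudoinverses and the mean projection\<close>

text \<open>
  \<open>B X\<close> and \<open>B Y\<close> are orthogonal projections with the same range, hence equal, and likewise
  \<open>X B\<close> and \<open>Y B\<close>. Each candidate is recovered from these products, as \<open>X = X B X\<close>.
\<close>
lemma is_pseudoinverse_unique:
  assumes X: "is_pseudoinverse B X" and Y: "is_pseudoinverse B Y"
  shows "X = Y"
proof -
  note x = X[unfolded is_pseudoinverse_def] and y = Y[unfolded is_pseudoinverse_def]
  have l: "B ** X = B ** Y"
  proof -
    have "B ** X = (B ** Y) ** (B ** X)" using y by (simp add: matrix_mul_assoc)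
    also have "\<dots> = transpose ((B ** X) ** (B ** Y))" using x y by (simp add: matrix_transpose_mul)
    also have "(B ** X) ** (B ** Y) = B ** Y" using x by (simp add: matrix_mul_assoc)
    finally show ?thesis using y by simp
  qed
  have r: "X ** B = Y ** B"
  proof -
    have "X ** B = (X ** B) ** (Y ** B)" using y by (metis matrix_mul_assoc)
    also have "\<dots> = transpose ((Y ** B) ** (X ** B))" using x y by (simp add: matrix_transpose_mul)
    also have "(Y ** B) ** (X ** B) = Y ** B" using x by (metis matrix_mul_assoc)
    finally show ?thesis using y by simp
  qed
  have "X = X ** (B ** X)" using x by (simp add: matrix_mul_assoc)
  also have "\<dots> = (Y ** B) ** Y" unfolding l by (simp add: matrix_mul_assoc r)
  finally show ?thesis using y by simp
qed

lemma pseudoinverse_eqI: "is_pseudoinverse B X \<Longrightarrow> pseudoinverse B = X"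
  unfolding pseudoinverse_def by (blast intro: is_pseudoinverse_unique)

text \<open>Multiplication by this matrix replaces every entry of a vector by the mean.\<close>
definition mean_matrix :: "real^'n^'n" where
  "mean_matrix = (\<chi> i j. 1 / real CARD('n))"

lemma transpose_mean_matrix: "transpose mean_matrix = mean_matrix"
  by (simp add: vec_eq_iff transpose_def mean_matrix_def)

lemma mean_matrix_idem: "mean_matrix ** mean_matrix = mean_matrix"
  by (simp add: vec_eq_iff matrix_matrix_mult_def mean_matrix_def)

text \<open>
  A matrix whose kernel and cokernel are the constants has a pseudoinverse that inverts it on
  mean-zero vectors and annihilates constants. The criterion serves for the Laplacian, for the
  symmetry of its pseudoinverse, and for its square.
\<close>
lemma pseudoinverse_eq_if_centering:
  fixes B X :: "real^'n^'n"
  assumes BX: "B ** X = mat 1 - mean_matrix" and XB: "X ** B = mat 1 - mean_matrix"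
    and JB: "mean_matrix ** B = 0" and JX: "mean_matrix ** X = 0"
  shows "pseudoinverse B = X"
proof (rule pseudoinverse_eqI)
  show "is_pseudoinverse B X"
    unfolding is_pseudoinverse_def BX XB
    by (simp add: matrix_diff_rdistrib transpose_diff transpose_mean_matrix JB JX)
qed


section \<open>The Laplacian\<close>

lemma laplacian_symmetric:
  assumes "undirected_graph E A"
  shows "transpose (laplacian A) = laplacian A"
proof -
  have "A $ j $ i = A $ i $ j" for i j
    using assms unfolding undirected_graph_def by (blast intro: symmetric_matrix_component)
  thus ?thesis by (simp add: vec_eq_iff transpose_def laplacian_def degree_matrix_def)
qed

lemma laplacian_row_sum: "(\<Sum>l\<in>UNIV. laplacian A $ i $ l) = 0"
  by (simp add: laplacian_def degree_matrix_def sum_subtractf)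

lemma laplacian_quadratic_form:
  fixes A :: "real^'n^'n"
  assumes "undirected_graph E A"
  shows "x \<bullet> (laplacian A *v x) = (\<Sum>i\<in>UNIV. \<Sum>j\<in>UNIV. A $ i $ j * (x $ i - x $ j)\<^sup>2) / 2"
proof -
  have sym: "A $ j $ i = A $ i $ j" for i j
    using assms unfolding undirected_graph_def by (blast intro: symmetric_matrix_component)
  have row: "(laplacian A *v x) $ i = (\<Sum>j\<in>UNIV. A $ i $ j * (x $ i - x $ j))" for i
  proof -
    have "(laplacian A *v x) $ i
        = (\<Sum>j\<in>UNIV. (if i = j then (\<Sum>l\<in>UNIV. A $ i $ l) * x $ j else 0) - A $ i $ j * x $ j)"
      unfolding matrix_vector_mult_def laplacian_def degree_matrix_def
      by (auto intro!: sum.cong simp: left_diff_distrib)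
    thus ?thesis by (simp add: sum_subtractf right_diff_distrib sum_distrib_right)
  qed
  define T where "T = (\<Sum>i\<in>UNIV. \<Sum>j\<in>UNIV. A $ i $ j * (x $ i - x $ j) * x $ i)"
  have T: "x \<bullet> (laplacian A *v x) = T"
    by (simp add: inner_vec_def row T_def sum_distrib_left mult_ac)
  have T': "T = (\<Sum>i\<in>UNIV. \<Sum>j\<in>UNIV. A $ i $ j * (x $ j - x $ i) * x $ j)"
    unfolding T_def by (subst sum.swap) (simp add: sym)
  have "T + T = (\<Sum>i\<in>UNIV. \<Sum>j\<in>UNIV. A $ i $ j * (x $ i - x $ j)\<^sup>2)"
    by (subst (2) T', unfold T_def sum.distrib[symmetric])
       (simp add: power2_eq_square algebra_simps)
  thus ?thesis using T by simp
qed

lemma laplacian_psd: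
  assumes "undirected_graph E A"
  shows "x \<bullet> (laplacian A *v x) \<ge> 0"
proof -
  have "A $ i $ j \<ge> 0" for i j
    using assms unfolding undirected_graph_def by (metis order.refl less_imp_le)
  thus ?thesis unfolding laplacian_quadratic_form[OF assms] by (simp add: sum_nonneg)
qed

text \<open>
  The energy is a sum of nonnegative terms, one per edge; if it vanishes, \<open>x\<close> agrees on the
  two ends of every edge and hence along every path.
\<close>
lemma laplacian_kernel:
  assumes gr: "undirected_graph E A" and con: "connected_graph E"
    and z: "x \<bullet> (laplacian A *v x) = 0"
  shows "x $ i = x $ j"
proof -
  have nn: "A $ i $ j \<ge> 0" for i j
    using gr unfolding undirected_graph_def by (metis order.refl less_imp_le)
  have z': "A $ i $ j * (x $ i - x $ j)\<^sup>2 = 0" for i j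
  proof -
    have "(\<Sum>i\<in>UNIV. \<Sum>j\<in>UNIV. A $ i $ j * (x $ i - x $ j)\<^sup>2) = 0"
      using z unfolding laplacian_quadratic_form[OF gr] by simp
    hence "(\<Sum>j\<in>UNIV. A $ i $ j * (x $ i - x $ j)\<^sup>2) = 0"
      by (subst (asm) sum_nonneg_eq_0_iff) (auto simp: sum_nonneg nn)
    thus ?thesis by (subst (asm) sum_nonneg_eq_0_iff) (auto simp: nn)
  qed
  have edge: "x $ i = x $ j" if "(i, j) \<in> E" for i j
  proof -
    have "A $ i $ j > 0" using that gr unfolding undirected_graph_def by metis
    thus ?thesis using z'[of i j] by simp
  qed
  have "(i, j) \<in> E\<^sup>*" using con unfolding connected_graph_def by blast
  thus ?thesis by (induction rule: rtrancl_induct) (auto dest: edge)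
qed

lemma laplacian_mean_matrix:
  assumes "undirected_graph E A"
  shows "laplacian A ** mean_matrix = 0" "mean_matrix ** laplacian A = 0"
proof -
  show LJ: "laplacian A ** mean_matrix = 0"
    by (simp add: vec_eq_iff matrix_matrix_mult_def mean_matrix_def sum_divide_distrib[symmetric]
        laplacian_row_sum)
  have "transpose (laplacian A ** mean_matrix) = mean_matrix ** laplacian A"
    by (simp add: matrix_transpose_mul laplacian_symmetric[OF assms] transpose_mean_matrix)
  thus "mean_matrix ** laplacian A = 0"
    unfolding LJ by (simp add: vec_eq_iff transpose_def)
qed

text \<open>
  Adding \<open>J\<close> repairs exactly the defect of the Laplacian: a vector of zero energy is constant, and
  a constant with zero sum is zero. This yields an honest inverse from which the pseudoinverse
  is read off.
\<close>
lemma laplacian_plus_mean_positive_definite: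
  fixes A :: "real^'n^'n"
  assumes gr: "undirected_graph E A" and con: "connected_graph E"
  shows "positive_definite (laplacian A + mean_matrix)"
  unfolding positive_definite_def
proof (intro allI impI)
  fix x :: "real^'n" assume "x \<noteq> 0"
  define s where "s = (\<Sum>i\<in>UNIV. x $ i)"
  have J: "x \<bullet> (mean_matrix *v x) = s\<^sup>2 / real CARD('n)"
    by (simp add: inner_vec_def matrix_vector_mult_def mean_matrix_def s_def power2_eq_square
        sum_distrib_right sum_divide_distrib[symmetric])
  have q: "x \<bullet> ((laplacian A + mean_matrix) *v x)
      = x \<bullet> (laplacian A *v x) + s\<^sup>2 / real CARD('n)"
    by (simp add: matrix_vector_mult_add_rdistrib inner_add_right J)
  have "x \<bullet> (laplacian A *v x) + s\<^sup>2 / real CARD('n) \<noteq> 0"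
  proof
    assume z: "x \<bullet> (laplacian A *v x) + s\<^sup>2 / real CARD('n) = 0"
    have nn: "s\<^sup>2 / real CARD('n) \<ge> 0" by simp
    from z nn laplacian_psd[OF gr, of x] have "x \<bullet> (laplacian A *v x) = 0"
      and s0: "s\<^sup>2 / real CARD('n) = 0" by linarith+
    hence c: "x $ i = x $ j" for i j using laplacian_kernel[OF gr con] by blast
    have "x $ i = 0" for i
    proof -
      have "s = (\<Sum>j\<in>(UNIV::'n set). x $ i)" unfolding s_def by (intro sum.cong refl c)
      thus ?thesis using s0 by simp
    qed
    with \<open>x \<noteq> 0\<close> show False by (simp add: vec_eq_iff)
  qed
  thus "x \<bullet> ((laplacian A + mean_matrix) *v x) > 0"
    unfolding q using laplacian_psd[OF gr, of x]
    by (smt (verit) divide_nonneg_nonneg of_nat_0_le_iff zero_le_power2)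
qed

text \<open>
  The pseudoinverse is \<open>W - J\<close>, where \<open>W\<close> inverts \<open>L + J\<close>: the matrix \<open>W\<close> acts as the
  pseudoinverse on mean-zero vectors and fixes the constants, so subtracting \<open>J\<close> kills the latter.
\<close>
lemma laplacian_pseudoinverse:
  fixes A :: "real^'n^'n"
  assumes gr: "undirected_graph E A" and con: "connected_graph E"
  defines "P \<equiv> pseudoinverse (laplacian A)"
  shows "laplacian A ** P = mat 1 - mean_matrix" "P ** laplacian A = mat 1 - mean_matrix"
    "mean_matrix ** P = 0" "transpose P = P"
proof -
  let ?L = "laplacian A" and ?J = "mean_matrix :: real^'n^'n"
  obtain W where LJW: "(?L + ?J) ** W = mat 1"
    using positive_definite_right_inverse laplacian_plus_mean_positive_definite[OF gr con] by blast
  hence WLJ: "W ** (?L + ?J) = mat 1" by (simp add: matrix_left_right_inverse)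
  note LJ = laplacian_mean_matrix[OF gr]
  have "(?L + ?J) ** ?J = ?J" "?J ** (?L + ?J) = ?J"
    by (simp_all add: matrix_add_rdistrib matrix_add_ldistrib LJ mean_matrix_idem)
  hence WJ: "W ** ?J = ?J" and JW: "?J ** W = ?J"
    using LJW WLJ by (metis matrix_mul_assoc matrix_mul_lid matrix_mul_rid)+
  have LW: "?L ** W = mat 1 - ?J" and WL: "W ** ?L = mat 1 - ?J"
    using LJW WLJ by (simp_all add: matrix_add_rdistrib matrix_add_ldistrib WJ JW eq_diff_eq)
  have P: "P = W - ?J"
    unfolding P_def
    by (rule pseudoinverse_eq_if_centering)
       (simp_all add: matrix_diff_ldistrib matrix_diff_rdistrib LJ LW WL JW mean_matrix_idem)
  show LP: "?L ** P = mat 1 - ?J" and PL: "P ** ?L = mat 1 - ?J" and JP: "?J ** P = 0"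
    by (simp_all add: P matrix_diff_ldistrib matrix_diff_rdistrib LJ LW WL JW mean_matrix_idem)
  have PJ: "P ** ?J = 0" by (simp add: P matrix_diff_rdistrib WJ mean_matrix_idem)
  \<comment> \<open>The transpose satisfies the same criterion because \<open>L\<close> and \<open>J\<close> are symmetric.\<close>
  have "pseudoinverse ?L = transpose P"
  proof (rule pseudoinverse_eq_if_centering)
    show "?L ** transpose P = mat 1 - ?J" "transpose P ** ?L = mat 1 - ?J"
      using arg_cong[OF PL, of transpose] arg_cong[OF LP, of transpose]
      by (simp_all add: matrix_transpose_mul laplacian_symmetric[OF gr] transpose_diff
          transpose_mean_matrix)
    show "?J ** ?L = 0" by (rule LJ)
    show "?J ** transpose P = 0"
      using arg_cong[OF PJ, of transpose]
      by (simp add: matrix_transpose_mul transpose_mean_matrix) (simp add: vec_eq_iff transpose_def)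
  qed
  thus "transpose P = P" by (simp add: P_def)
qed

lemma pseudoinverse_laplacian_square:
  fixes A :: "real^'n^'n"
  assumes gr: "undirected_graph E A" and con: "connected_graph E"
  defines "P \<equiv> pseudoinverse (laplacian A)"
  shows "pseudoinverse (laplacian A ** laplacian A) = P ** P"
proof -
  let ?L = "laplacian A" and ?J = "mean_matrix :: real^'n^'n"
  note P = laplacian_pseudoinverse[OF gr con, folded P_def]
  note LJ = laplacian_mean_matrix[OF gr]
  show ?thesis
  proof (rule pseudoinverse_eq_if_centering)
    have "?L ** ?L ** (P ** P) = ?L ** (?L ** P) ** P" by (simp add: matrix_mul_assoc)
    thus "?L ** ?L ** (P ** P) = mat 1 - ?J" by (simp add: P matrix_diff_ldistrib LJ)
    have "P ** P ** (?L ** ?L) = P ** ((P ** ?L) ** ?L)" by (simp add: matrix_mul_assoc)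
    thus "P ** P ** (?L ** ?L) = mat 1 - ?J" by (simp add: P matrix_diff_rdistrib LJ)
  qed (simp_all add: matrix_mul_assoc P LJ)
qed

text \<open>
  The resistance distance is the energy of the potential \<open>P v\<close> of a unit current from \<open>i\<close> to
  \<open>j\<close>. Its sign ensures that the denominators \<open>2 + k r\<close> are positive.
\<close>
lemma resistance_distance_nonneg:
  fixes A :: "real^'n^'n"
  assumes gr: "undirected_graph E A" and con: "connected_graph E"
  shows "resistance_distance A i j \<ge> 0"
proof -
  define P where "P = pseudoinverse (laplacian A)"
  note P = laplacian_pseudoinverse[OF gr con, folded P_def]
  define v :: "real^'n" where "v = axis i 1 - axis j 1"
  have Pv: "(P *v v) $ l = P $ l $ i - P $ l $ j" for l
    by (simp add: v_def matrix_vector_mult_diff_distrib matrix_vector_mult_basis column_def)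
  have "mean_matrix *v v = 0"
    by (simp add: v_def matrix_vector_mult_diff_distrib matrix_vector_mult_basis column_def
        mean_matrix_def)
  hence LPv: "laplacian A *v (P *v v) = v"
    by (simp add: matrix_vector_mul_assoc P matrix_vector_mult_diff_rdistrib)
  have "P $ j $ i = P $ i $ j" using P(4) by (rule symmetric_matrix_component)
  hence "resistance_distance A i j = (P *v v) \<bullet> (laplacian A *v (P *v v))"
    unfolding LPv
    by (simp add: resistance_distance_def P_def[symmetric] inner_diff_right inner_axis Pv v_def)
       (simp add: Pv[unfolded v_def])
  thus ?thesis using laplacian_psd[OF gr] by simp
qed

lemma biharmonic_distance_eq:
  fixes A :: "real^'n^'n"
  assumes gr: "undirected_graph E A" and con: "connected_graph E"
  defines "P \<equiv> pseudoinverse (laplacian A)"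
  shows "biharmonic_distance A i j = (\<Sum>l\<in>UNIV. (P $ l $ i - P $ l $ j)\<^sup>2)"
proof -
  have sym: "P $ l $ m = P $ m $ l" for l m
    using laplacian_pseudoinverse(4)[OF gr con, folded P_def] by (rule symmetric_matrix_component)
  show ?thesis
    unfolding biharmonic_distance_def Let_def pseudoinverse_laplacian_square[OF gr con]
      P_def[symmetric] matrix_matrix_mult_component sum_distrib_left sum.distrib[symmetric]
      sum_subtractf[symmetric]
    by (intro sum.cong refl) (simp add: sym[of i] sym[of j] power2_eq_square algebra_simps)
qed


section \<open>The leader-follower matrix\<close>

lemma dynamics_matrix_symmetric:
  assumes "undirected_graph E A"
  shows "transpose (dynamics_matrix A k S) = dynamics_matrix A k S"
proof -
  have "laplacian A $ j $ i = laplacian A $ i $ j" for i j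
    using laplacian_symmetric[OF assms] by (rule symmetric_matrix_component)
  thus ?thesis
    by (auto simp: vec_eq_iff transpose_def dynamics_matrix_def leader_gain_matrix_def)
qed

text \<open>
  Zero energy forces a constant vector, and the gain at any one leader then forces it to be zero.
\<close>
lemma dynamics_matrix_positive_definite:
  fixes A :: "real^'n^'n"
  assumes gr: "undirected_graph E A" and con: "connected_graph E" and k: "k > 0" and S: "S \<noteq> {}"
  shows "positive_definite (dynamics_matrix A k S)"
  unfolding positive_definite_def
proof (intro allI impI)
  fix x :: "real^'n" assume "x \<noteq> 0"
  have "x \<bullet> (leader_gain_matrix k S *v x) = (\<Sum>i\<in>UNIV. if i \<in> S then k * (x $ i)\<^sup>2 else 0)"
  proof -
    have "(leader_gain_matrix k S *v x) $ i = (if i \<in> S then k * x $ i else 0)" for i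
      unfolding matrix_vector_mult_def leader_gain_matrix_def
      by (simp add: if_distrib[of "\<lambda>c. c * _"] cong: if_cong)
    thus ?thesis
      by (auto simp: inner_vec_def power2_eq_square intro!: sum.cong)
  qed
  hence K: "x \<bullet> (leader_gain_matrix k S *v x) = (\<Sum>i\<in>S. k * (x $ i)\<^sup>2)"
    by (simp add: sum.If_cases)
  have q: "x \<bullet> (dynamics_matrix A k S *v x)
      = x \<bullet> (laplacian A *v x) + (\<Sum>i\<in>S. k * (x $ i)\<^sup>2)"
    by (simp add: dynamics_matrix_def matrix_vector_mult_add_rdistrib inner_add_right K)
  have nn: "(\<Sum>i\<in>S. k * (x $ i)\<^sup>2) \<ge> 0" using k by (simp add: sum_nonneg)
  have "x \<bullet> (dynamics_matrix A k S *v x) \<noteq> 0"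
  proof
    assume "x \<bullet> (dynamics_matrix A k S *v x) = 0"
    with q nn laplacian_psd[OF gr, of x] have z: "x \<bullet> (laplacian A *v x) = 0"
      and s0: "(\<Sum>i\<in>S. k * (x $ i)\<^sup>2) = 0" by linarith+
    obtain s where s: "s \<in> S" using S by blast
    have "k * (x $ s)\<^sup>2 = 0"
      using s0 s k by (subst (asm) sum_nonneg_eq_0_iff) auto
    hence "x $ s = 0" using k by simp
    hence "x $ i = 0" for i using laplacian_kernel[OF gr con z, of i s] by simp
    with \<open>x \<noteq> 0\<close> show False by (simp add: vec_eq_iff)
  qed
  thus "x \<bullet> (dynamics_matrix A k S *v x) > 0"
    using q nn laplacian_psd[OF gr, of x] by linarith
qed

text \<open>
  The bracket whose inverse occurs in the joint centrality. It is named after what it will turn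
  out to be: the trace of the inverse of the dynamics matrix of two leaders.
\<close>
definition leader_pair_trace :: "real^'n^'n \<Rightarrow> real \<Rightarrow> 'n \<Rightarrow> 'n \<Rightarrow> real" where
  "leader_pair_trace A k s1 s2 =
     (let n = real CARD('n);
          P = pseudoinverse (laplacian A);
          r = resistance_distance A s1 s2;
          \<gamma> = biharmonic_distance A s1 s2
      in kirchhoff_index A / n
         + n * (1 + k * (P $ s1 $ s1 + P $ s2 $ s2)) / (k * (2 + k * r))
         + (n * k\<^sup>2 * (P $ s1 $ s1 * P $ s2 $ s2 - (P $ s1 $ s2)\<^sup>2) - k\<^sup>2 * \<gamma>)
           / (k * (2 + k * r)))"

lemma joint_centrality_eq:
  fixes A :: "real^'n^'n"
  shows "joint_centrality A k s1 s2 = real CARD('n) / leader_pair_trace A k s1 s2"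
  by (simp add: joint_centrality_def leader_pair_trace_def Let_def divide_inverse)

text \<open>
  In the network picture, column \<open>j\<close> of the inverse \<open>N\<close> is the potential when a unit current is
  injected at \<open>j\<close> and leaves through the two grounded leaders. The fractions leaving there are
  \<open>\<alpha> + (k / d) p\<^sub>j\<close> and \<open>\<beta> - (k / d) p\<^sub>j\<close>, whose sum \<open>\<alpha> + \<beta>\<close> is one by conservation of current.
  Applying \<open>P\<close> to injected minus outgoing current gives \<open>P e\<^sub>j - (k / d) p\<^sub>j p - q\<close> up to an additive
  constant depending on \<open>j\<close>, which symmetry of \<open>N\<close> forces to be \<open>c - q\<^sub>j\<close>.
\<close>
lemma dynamics_matrix_inverse_two_leaders:
  fixes A :: "real^'n^'n"
  assumes gr: "undirected_graph E A" and con: "connected_graph E" and k: "k > 0"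
    and ne: "s1 \<noteq> s2"
  obtains N where "dynamics_matrix A k {s1, s2} ** N = mat 1"
    and "trace N = leader_pair_trace A k s1 s2"
proof -
  define n where "n = real CARD('n)"
  have n: "n > 0" by (simp add: n_def)
  define P where "P = pseudoinverse (laplacian A)"
  note LP = laplacian_pseudoinverse[OF gr con, folded P_def]
  have sym: "P $ l $ m = P $ m $ l" for l m
    using LP(4) by (rule symmetric_matrix_component)
  have P0: "(\<Sum>l\<in>UNIV. P $ l $ j) = 0" for j
  proof -
    have "(mean_matrix ** P) $ j $ j = 0" by (simp add: LP)
    thus ?thesis
      by (simp add: matrix_matrix_mult_def mean_matrix_def sum_divide_distrib[symmetric])
  qed
  define a b g where "a = P $ s1 $ s1" and "b = P $ s2 $ s2" and "g = P $ s1 $ s2"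
  define r where "r = a + b - 2 * g"
  have r: "resistance_distance A s1 s2 = r"
    by (simp add: resistance_distance_def Let_def r_def a_def b_def g_def P_def)
  define d where "d = 2 + k * r"
  have d: "d > 0"
    using resistance_distance_nonneg[OF gr con, of s1 s2] k by (simp add: r d_def add_pos_nonneg)
  define \<alpha> \<beta> where "\<alpha> = (1 + k * (b - g)) / d" and "\<beta> = (1 + k * (a - g)) / d"
  \<comment> \<open>This makes \<open>\<alpha> e\<^sub>1 + \<beta> e\<^sub>2\<close> a unit current, so that \<open>L q\<close> is that current minus its mean and the
    two means \<open>1 / n\<close> cancel in \<open>L N\<close>.\<close>
  have \<alpha>\<beta>: "\<alpha> + \<beta> = 1"
    using d by (simp add: \<alpha>_def \<beta>_def add_divide_distrib[symmetric])
       (simp add: d_def r_def algebra_simps)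
  \<comment> \<open>The numerator is the determinant of \<open>I + k R\<close>, where \<open>R\<close> is the block of \<open>P\<close> at the two
    leaders. The value is fixed by Ohm's law at the leaders, the facts \<open>c1\<close> below.\<close>
  define c where "c = (1 + k * (a + b) + k\<^sup>2 * (a * b - g\<^sup>2)) / (k * d)"
  have d\<alpha>: "d * \<alpha> = 1 + k * (b - g)" and d\<beta>: "d * \<beta> = 1 + k * (a - g)"
    and dc: "d * (k * c) = 1 + k * (a + b) + k\<^sup>2 * (a * b - g\<^sup>2)"
    using d k by (simp_all add: \<alpha>_def \<beta>_def c_def)
  define p where "p j = P $ s1 $ j - P $ s2 $ j" for j
  define q where "q j = \<alpha> * P $ s1 $ j + \<beta> * P $ s2 $ j" for j
  define N :: "real^'n^'n" where
    "N = (\<chi> i j. P $ i $ j - k / d * p i * p j - q j - q i + c)"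
  have N: "N $ i $ j = P $ i $ j - k / d * p i * p j - q j - q i + c" for i j
    by (simp add: N_def)
  let ?\<delta> = "\<lambda>i j::'n. if i = j then 1 else 0 :: real"
  have LPc: "(\<Sum>l\<in>UNIV. laplacian A $ i $ l * P $ l $ j) = ?\<delta> i j - 1 / n" for i j
    using arg_cong[OF LP(1), of "\<lambda>X. X $ i $ j"]
    by (simp add: matrix_matrix_mult_def mat_def mean_matrix_def n_def)
  have Lp: "(\<Sum>l\<in>UNIV. laplacian A $ i $ l * p l) = ?\<delta> i s1 - ?\<delta> i s2" for i
    unfolding p_def sym[of s1] sym[of s2] right_diff_distrib sum_subtractf LPc by simp
  have Lq: "(\<Sum>l\<in>UNIV. laplacian A $ i $ l * q l) = \<alpha> * ?\<delta> i s1 + \<beta> * ?\<delta> i s2 - 1 / n" for i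
  proof -
    have "(\<Sum>l\<in>UNIV. laplacian A $ i $ l * q l)
        = \<alpha> * (\<Sum>l\<in>UNIV. laplacian A $ i $ l * P $ l $ s1)
          + \<beta> * (\<Sum>l\<in>UNIV. laplacian A $ i $ l * P $ l $ s2)"
      unfolding q_def sym[of s1] sym[of s2] by (simp add: algebra_simps sum.distrib sum_distrib_left)
    also have "\<dots> = \<alpha> * ?\<delta> i s1 + \<beta> * ?\<delta> i s2 - (\<alpha> + \<beta>) / n"
      unfolding LPc by (simp add: algebra_simps add_divide_distrib)
    finally show ?thesis by (simp add: \<alpha>\<beta>)
  qed
  have LN: "(\<Sum>l\<in>UNIV. laplacian A $ i $ l * N $ l $ j)
      = ?\<delta> i j - k / d * (?\<delta> i s1 - ?\<delta> i s2) * p j - (\<alpha> * ?\<delta> i s1 + \<beta> * ?\<delta> i s2)" for i j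
  proof -
    have "(\<Sum>l\<in>UNIV. laplacian A $ i $ l * N $ l $ j)
        = (\<Sum>l\<in>UNIV. laplacian A $ i $ l * P $ l $ j)
          - k / d * p j * (\<Sum>l\<in>UNIV. laplacian A $ i $ l * p l)
          - (\<Sum>l\<in>UNIV. laplacian A $ i $ l * q l)
          + (c - q j) * (\<Sum>l\<in>UNIV. laplacian A $ i $ l)"
      unfolding N sum_distrib_left sum_subtractf[symmetric] sum.distrib[symmetric]
      by (intro sum.cong refl) (simp add: algebra_simps)
    thus ?thesis unfolding LPc Lp Lq laplacian_row_sum by (simp add: algebra_simps)
  qed
  have ps: "p s1 = a - g" "p s2 = g - b" and qs: "q s1 = \<alpha> * a + \<beta> * g" "q s2 = \<alpha> * g + \<beta> * b"
    by (simp_all add: p_def q_def a_def b_def g_def sym[of s2 s1])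
  \<comment> \<open>Ohm's law at each leader: \<open>k\<close> times its potential is the outgoing current.\<close>
  have KN1: "k * N $ s1 $ j = k / d * p j + \<alpha>" for j
  proof -
    have "d * (k * (c - q s1)) = d * (k * c) - k * (d * \<alpha> * a + d * \<beta> * g)"
      unfolding qs by (simp add: algebra_simps)
    also have "\<dots> = d * \<alpha>"
      unfolding d\<alpha> d\<beta> dc by (simp add: algebra_simps power2_eq_square)
    finally have c1: "k * (c - q s1) = \<alpha>" using d by simp
    have "d * (1 - k / d * p s1 - \<alpha>) = d - k * (a - g) - d * \<alpha>"
      using d unfolding ps by (simp add: right_diff_distrib)
    also have "\<dots> = 1" unfolding d\<alpha> by (simp add: d_def r_def algebra_simps)
    finally have cf: "1 - k / d * p s1 - \<alpha> = 1 / d"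
      using d by (metis less_irrefl mult.commute nonzero_eq_divide_eq)
    have "N $ s1 $ j = (1 - k / d * p s1 - \<alpha>) * P $ s1 $ j + (k / d * p s1 - \<beta>) * P $ s2 $ j
        + (c - q s1)"
      unfolding N by (simp add: p_def[of j] q_def[of j] algebra_simps)
    also have "k / d * p s1 - \<beta> = - (1 / d)" using cf \<alpha>\<beta> by linarith
    finally have "N $ s1 $ j = p j / d + (c - q s1)"
      unfolding cf by (simp add: p_def[of j] diff_divide_distrib)
    hence "k * N $ s1 $ j = k * (p j / d) + k * (c - q s1)"
      by (simp only: distrib_left mult_minus_right)
    thus ?thesis using c1 by simp
  qed
  have KN2: "k * N $ s2 $ j = - (k / d * p j) + \<beta>" for j
  proof -
    have "d * (k * (c - q s2)) = d * (k * c) - k * (d * \<alpha> * g + d * \<beta> * b)"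
      unfolding qs by (simp add: algebra_simps)
    also have "\<dots> = d * \<beta>"
      unfolding d\<alpha> d\<beta> dc by (simp add: algebra_simps power2_eq_square)
    finally have c1: "k * (c - q s2) = \<beta>" using d by simp
    have "d * (1 + k / d * p s2 - \<beta>) = d - k * (b - g) - d * \<beta>"
      using d unfolding ps by (simp add: distrib_left right_diff_distrib)
    also have "\<dots> = 1" unfolding d\<beta> by (simp add: d_def r_def algebra_simps)
    finally have cf: "1 + k / d * p s2 - \<beta> = 1 / d"
      using d by (metis less_irrefl mult.commute nonzero_eq_divide_eq)
    have "N $ s2 $ j = (- (k / d * p s2) - \<alpha>) * P $ s1 $ j + (1 + k / d * p s2 - \<beta>) * P $ s2 $ j
        + (c - q s2)"
      unfolding N by (simp add: p_def[of j] q_def[of j] algebra_simps)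
    also have "- (k / d * p s2) - \<alpha> = - (1 / d)" using cf \<alpha>\<beta> by linarith
    finally have "N $ s2 $ j = - (p j / d) + (c - q s2)"
      unfolding cf by (simp add: p_def[of j] diff_divide_distrib)
    hence "k * N $ s2 $ j = - (k * (p j / d)) + k * (c - q s2)"
      by (simp only: distrib_left mult_minus_right)
    thus ?thesis using c1 by simp
  qed
  have "dynamics_matrix A k {s1, s2} ** N = mat 1"
  proof -
    have "(dynamics_matrix A k {s1, s2} ** N) $ i $ j = ?\<delta> i j" for i j
    proof -
      have "(leader_gain_matrix k {s1, s2} ** N) $ i $ j
          = (if i \<in> {s1, s2} then k * N $ i $ j else 0)"
        unfolding matrix_matrix_mult_component leader_gain_matrix_def
        by (simp add: if_distrib[of "\<lambda>c. c * _"] cong: if_cong)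
      hence "(dynamics_matrix A k {s1, s2} ** N) $ i $ j
          = (\<Sum>l\<in>UNIV. laplacian A $ i $ l * N $ l $ j)
            + (if i \<in> {s1, s2} then k * N $ i $ j else 0)"
        by (simp add: dynamics_matrix_def matrix_add_rdistrib matrix_matrix_mult_component)
      thus ?thesis unfolding LN using ne by (auto simp: KN1 KN2)
    qed
    thus ?thesis by (simp add: vec_eq_iff mat_def)
  qed
  moreover have "trace N = leader_pair_trace A k s1 s2"
  proof -
    have \<gamma>: "(\<Sum>l\<in>UNIV. (p l)\<^sup>2) = biharmonic_distance A s1 s2"
      unfolding biharmonic_distance_eq[OF gr con] P_def[symmetric] p_def sym[of s1] sym[of s2] ..
    have q0: "(\<Sum>l\<in>UNIV. q l) = 0"
      unfolding q_def sym[of s1] sym[of s2] by (simp add: sum.distrib sum_distrib_left[symmetric] P0)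
    have "trace N = trace P - k / d * (\<Sum>l\<in>UNIV. (p l)\<^sup>2) - 2 * (\<Sum>l\<in>UNIV. q l) + n * c"
      by (simp add: trace_def N sum.distrib sum_subtractf sum_distrib_left n_def power2_eq_square
          mult.assoc)
    hence "trace N = trace P - k / d * biharmonic_distance A s1 s2 + n * c"
      by (simp add: \<gamma> q0)
    also have "\<dots> = trace P + n * (1 + k * (a + b)) / (k * d)
        + (n * k\<^sup>2 * (a * b - g\<^sup>2) - k\<^sup>2 * biharmonic_distance A s1 s2) / (k * d)"
    proof -
      have "k / d * biharmonic_distance A s1 s2 = k\<^sup>2 * biharmonic_distance A s1 s2 / (k * d)"
        using k by (simp add: power2_eq_square)
      moreover have "n * c = n * (1 + k * (a + b)) / (k * d) + n * k\<^sup>2 * (a * b - g\<^sup>2) / (k * d)"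
        unfolding c_def by (simp add: add_divide_distrib[symmetric] distrib_left mult.assoc)
      ultimately show ?thesis by (simp add: diff_divide_distrib)
    qed
    also have "\<dots> = leader_pair_trace A k s1 s2"
      using n by (simp add: leader_pair_trace_def kirchhoff_index_def Let_def r d_def
          P_def[symmetric] a_def b_def g_def n_def)
    finally show ?thesis .
  qed
  ultimately show ?thesis by (rule that)
qed

lemma leader_pair_trace_pos:
  assumes "undirected_graph E A" "connected_graph E" "k > 0" "s1 \<noteq> s2"
  shows "leader_pair_trace A k s1 s2 > 0"
proof -
  obtain N where "dynamics_matrix A k {s1, s2} ** N = mat 1"
    and "trace N = leader_pair_trace A k s1 s2"
    using dynamics_matrix_inverse_two_leaders[OF assms] .
  thus ?thesis
    using trace_inverse_positive dynamics_matrix_positive_definite[OF assms(1-3)]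
    by (metis insert_not_empty)
qed

lemma total_system_error_two_leaders:
  assumes "undirected_graph E A" "connected_graph E" "k > 0" "s1 \<noteq> s2"
  shows "total_system_error A k \<sigma> {s1, s2} = \<sigma>\<^sup>2 / 2 * leader_pair_trace A k s1 s2"
proof -
  obtain N where MN: "dynamics_matrix A k {s1, s2} ** N = mat 1"
    and tr: "trace N = leader_pair_trace A k s1 s2"
    using dynamics_matrix_inverse_two_leaders[OF assms] .
  have pd: "positive_definite (dynamics_matrix A k {s1, s2})"
    by (rule dynamics_matrix_positive_definite[OF assms(1-3)]) simp
  have "total_system_error A k \<sigma> {s1, s2} = trace ((\<sigma>\<^sup>2 / 2) *\<^sub>R N)"
    unfolding total_system_error_def
      steady_state_covariance_eq[OF pd dynamics_matrix_symmetric[OF assms(1)] MN] ..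
  also have "\<dots> = \<sigma>\<^sup>2 / 2 * trace N"
    unfolding trace_def sum_distrib_left by (intro sum.cong refl) simp
  finally show ?thesis unfolding tr .
qed

theorem theorem2:
  fixes A :: "real^'n^'n" and E :: "('n \<times> 'n) set" and k \<sigma> :: real
  assumes "undirected_graph E A"
    and "connected_graph E"
    and "k > 0"
    and "\<sigma> > 0"
  shows "(\<forall>s1 s2. s1 \<noteq> s2 \<longrightarrow>
            (\<Sum>i\<in>UNIV. steady_state_covariance (dynamics_matrix A k {s1, s2}) \<sigma> $ i $ i)
              = \<sigma>\<^sup>2 / 2 * (real CARD('n) / joint_centrality A k s1 s2))
       \<and> {S. optimal_leader_set A k \<sigma> 2 S}
           = {{s1, s2} | s1 s2.
                is_arg_max (\<lambda>(u, v). joint_centrality A k u v) (\<lambda>(u, v). u \<noteq> v) (s1, s2)}"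
proof (intro conjI)
  note err = total_system_error_two_leaders[OF assms(1-3)]
  show "\<forall>s1 s2. s1 \<noteq> s2 \<longrightarrow>
      (\<Sum>i\<in>UNIV. steady_state_covariance (dynamics_matrix A k {s1, s2}) \<sigma> $ i $ i)
        = \<sigma>\<^sup>2 / 2 * (real CARD('n) / joint_centrality A k s1 s2)"
    using err by (simp add: total_system_error_def trace_def joint_centrality_eq)
  \<comment> \<open>Positivity of the two traces is what makes their reciprocals compare in reverse order.\<close>
  have less: "joint_centrality A k s1 s2 < joint_centrality A k u v
      \<longleftrightarrow> total_system_error A k \<sigma> {u, v} < total_system_error A k \<sigma> {s1, s2}"
    if "s1 \<noteq> s2" "u \<noteq> v" for s1 s2 u v
  proof -
    let ?t = "leader_pair_trace A k s1 s2" and ?u = "leader_pair_trace A k u v"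
    have "?t > 0" "?u > 0" by (rule leader_pair_trace_pos[OF assms(1-3)]; fact)+
    hence "real CARD('n) / ?t < real CARD('n) / ?u \<longleftrightarrow> ?u < ?t"
      by (simp add: divide_less_eq less_divide_eq)
    also have "\<dots> \<longleftrightarrow> \<sigma>\<^sup>2 / 2 * ?u < \<sigma>\<^sup>2 / 2 * ?t"
      using \<open>\<sigma> > 0\<close> by (intro mult_less_cancel_left_pos[symmetric]) simp
    finally show ?thesis unfolding joint_centrality_eq err[OF that(1)] err[OF that(2)] .
  qed
  have opt: "optimal_leader_set A k \<sigma> 2 {s1, s2}
      \<longleftrightarrow> is_arg_max (\<lambda>(u, v). joint_centrality A k u v) (\<lambda>(u, v). u \<noteq> v) (s1, s2)"
    if "s1 \<noteq> s2" for s1 s2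
  proof -
    have "optimal_leader_set A k \<sigma> 2 {s1, s2}
        \<longleftrightarrow> \<not> (\<exists>u v. u \<noteq> v \<and> total_system_error A k \<sigma> {u, v} < total_system_error A k \<sigma> {s1, s2})"
      using that unfolding optimal_leader_set_def is_arg_min_def card_2_iff by blast
    also have "\<dots> \<longleftrightarrow> \<not> (\<exists>u v. u \<noteq> v \<and> joint_centrality A k s1 s2 < joint_centrality A k u v)"
      using less[OF that] by blast
    finally show ?thesis using that by (simp add: is_arg_max_def)
  qed
  show "{S. optimal_leader_set A k \<sigma> 2 S} = {{s1, s2} | s1 s2.
      is_arg_max (\<lambda>(u, v). joint_centrality A k u v) (\<lambda>(u, v). u \<noteq> v) (s1, s2)}"
  proof (intro set_eqI iffI; clarsimp)
    fix S assume S: "optimal_leader_set A k \<sigma> 2 S"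
    then obtain s1 s2 where "S = {s1, s2}" "s1 \<noteq> s2"
      unfolding optimal_leader_set_def is_arg_min_def card_2_iff by blast
    thus "\<exists>s1 s2. S = {s1, s2} \<and>
        is_arg_max (\<lambda>(u, v). joint_centrality A k u v) (\<lambda>(u, v). u \<noteq> v) (s1, s2)"
      using S opt by blast
  next
    fix s1 s2
    assume m: "is_arg_max (\<lambda>(u, v). joint_centrality A k u v) (\<lambda>(u, v). u \<noteq> v) (s1, s2)"
    hence "s1 \<noteq> s2" unfolding is_arg_max_def by simp
    thus "optimal_leader_set A k \<sigma> 2 {s1, s2}" using m opt by blast
  qed
qed

end
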